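(* Let $n\ge 2$, let $A=[a_{ij}]\in M_n$ be a nonsingular $M$-matrix and $A^{-1}=[\alpha_{ij}]$. Then, for every $t=1,2,\ldots$, $$\tau(A)\geq \frac{1}{\max\limits_{i\in N}\Big\{\Big(1+\sum\limits_{k\neq i}p_{ki}^{(t)}\Big)\alpha_{ii}\Big\}}.$$
   Context: Let $N=\{1,\ldots,n\}$, $n\ge2$. All indices range over $N$. A matrix is called nonnegative ($\ge 0$) if all its entries are nonnegative. A matrix $A=[a_{ij}]\in\mathbb{R}^{n\times n}$ is a nonsingular $M$-matrix if $a_{ij}\le 0$ for all $i\ne j$ and $A$ is invertible with $A^{-1}\ge 0$; $M_n$ denotes the set of all $n\times n$ nonsingular $M$-matrices. For $A\in M_n$, $\tau(A)=\rho(A^{-1})^{-1}$, where $\rho$ denotes the spectral radius (the minimum eigenvalue of $A$; equivalently $\tau(A)=\min\{|\lambda|:\lambda\in\sigma(A)\}$). For $A=[a_{ij}]$ with $a_{ii}\ne0$, for $i,j\in N$, $j\ne i$, and $t=1,2,\ldots$, define $$r_i=\max_{j\neq i}\frac{|a_{ji}|}{|a_{jj}|-\sum_{k\ne j,i}|a_{jk}|},\qquad m_{ji}=\frac{|a_{ji}|+\sum_{k\ne j,i}|a_{jk}|r_i}{|a_{jj}|},$$ $$h_i=\max_{j\ne i}\frac{|a_{ji}|}{|a_{jj}|m_{ji}-\sum_{k\ne j,i}|a_{jk}|m_{ki}},\qquad u_{ji}=\frac{|a_{ji}|+\sum_{k\ne j,i}|a_{jk}|m_{ki}h_i}{|a_{jj}|},\qquad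 u^{(0)}_{ji}=u_{ji},$$ and recursively $$p^{(t)}_{ji}=\frac{|a_{ji}|+\sum_{k\ne j,i}|a_{jk}|u^{(t-1)}_{ki}}{|a_{jj}|},\qquad h^{(t)}_i=\max_{j\ne i}\frac{|a_{ji}|}{|a_{jj}|p^{(t)}_{ji}-\sum_{k\ne j,i}|a_{jk}|p^{(t)}_{ki}},\qquad u^{(t)}_{ji}=\frac{|a_{ji}|+\sum_{k\ne j,i}|a_{jk}|p^{(t)}_{ki}h^{(t)}_i}{|a_{jj}|}.$$
   Formalization: Adds the hypothesis that all denominators |a_jj| − Σ_{k≠j,i}|a_jk| in the definition of r_i are positive; without it the claim fails, e.g. for the M-matrix with rows (5,−2,0), (−5,4,−5), (0,−1,4) and t = 1. Quotients 0/0 in h_i are read as 0. *)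

theory Defs
  imports
    "Jordan_Normal_Form.Gauss_Jordan_Elimination"
    "Jordan_Normal_Form.Spectral_Radius"
begin

text \<open>The index set \<open>{1..n}\<close> of the mathematics is rendered as \<open>{..<n}\<close>.\<close>

definition inv_mat :: "real mat \<Rightarrow> real mat" where
  "inv_mat A = the (mat_inverse A)"

text \<open>Sanity check: for invertible matrices the Gauss-Jordan inverse is the inverse.\<close>

lemma inv_mat:
  assumes A: "A \<in> carrier_mat n n" and inv: "invertible_mat A"
  shows "inv_mat A \<in> carrier_mat n n"
    and "A * inv_mat A = 1\<^sub>m n"
    and "inv_mat A * A = 1\<^sub>m n"
proof -
  from inv obtain B where AB: "A * B = 1\<^sub>m n" and BA: "B * A = 1\<^sub>m (dim_row B)"
    using A unfolding invertible_mat_def inverts_mat_def by auto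
  have "dim_col B = n" using arg_cong[OF AB, of dim_col] by simp
  moreover have "dim_row B = n" using arg_cong[OF BA, of dim_col] A by simp
  ultimately have B: "B \<in> carrier_mat n n" by auto
  have BA': "B * A = 1\<^sub>m n" using BA B by simp
  have "A \<in> Units (ring_mat TYPE(real) n ())"
    using A B AB BA' unfolding Units_def ring_mat_def by auto
  then obtain C where "mat_inverse A = Some C"
    using mat_inverse(1)[OF A, where b = "()"] by (cases "mat_inverse A") auto
  then have *: "mat_inverse A = Some (inv_mat A)"
    unfolding inv_mat_def by simp
  show "inv_mat A \<in> carrier_mat n n" "A * inv_mat A = 1\<^sub>m n" "inv_mat A * A = 1\<^sub>m n"
    using mat_inverse(2)[OF A *] by auto
qed

definition M_matrices :: "nat \<Rightarrow> real mat set" where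
  "M_matrices n = {A \<in> carrier_mat n n.
     (\<forall>i<n. \<forall>j<n. i \<noteq> j \<longrightarrow> A $$ (i,j) \<le> 0) \<and>
     invertible_mat A \<and>
     (\<forall>i<n. \<forall>j<n. 0 \<le> inv_mat A $$ (i,j))}"

text \<open>The spectrum is taken over the complex numbers.\<close>

definition tau :: "real mat \<Rightarrow> real" where
  "tau A = inverse (spectral_radius (map_mat complex_of_real (inv_mat A)))"

definition off_sum :: "real mat \<Rightarrow> nat \<Rightarrow> nat \<Rightarrow> (nat \<Rightarrow> real) \<Rightarrow> real" where
  "off_sum A j i x = (\<Sum>k\<in>{..<dim_row A} - {j, i}. \<bar>A $$ (j,k)\<bar> * x k)"

definition max_off :: "real mat \<Rightarrow> nat \<Rightarrow> (nat \<Rightarrow> real) \<Rightarrow> real" where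
  "max_off A i f = Max (f ` ({..<dim_row A} - {i}))"

text \<open>
  Families such as $m_{ji}$ are written \<open>m_coeff A j i\<close>; they are only meaningful for \<open>j \<noteq> i\<close>.
  The same expressions occur both for the initial quantities and for the \<open>t\<close>-th iterates,
  so they are defined once, as functions of the family they are built from:
  $h_i$ and $u_{ji}$ are \<open>h_of A (m_coeff A) i\<close> and \<open>u_of A (m_coeff A) j i\<close>, whereas $h^{(t)}_i$ and
  $u^{(t)}_{ji}$ are \<open>h_of A (p_iter A t) i\<close> and \<open>u_of A (p_iter A t) j i\<close>.
  The division convention \<open>x / 0 = 0\<close> is used for quotients of the form 0/0, which can
  occur in \<open>h_of\<close> where \<open>A $$ (j,i) = 0\<close>.
\<close>

text \<open>
  These quantities are only meaningful if the denominators in \<open>r_max\<close> are positive, and the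
  theorem assumes this. That they are nonzero is not enough: for the M-matrix with rows
  \<open>(5,-2,0)\<close>, \<open>(-5,4,-5)\<close>, \<open>(0,-1,4)\<close> and \<open>t = 1\<close> no denominator vanishes, two of those in
  \<open>r_max\<close> are \<open>-1\<close>, and the bound is 4/9, which exceeds \<open>tau\<close>.
  Given positivity, the denominators in \<open>h_of\<close> are at least \<open>\<bar>A $$ (j,i)\<bar>\<close>.
\<close>

definition r_max :: "real mat \<Rightarrow> nat \<Rightarrow> real" where
  "r_max A i = max_off A i (\<lambda>j. \<bar>A $$ (j,i)\<bar> / (\<bar>A $$ (j,j)\<bar> - off_sum A j i (\<lambda>k. 1)))"

definition m_coeff :: "real mat \<Rightarrow> nat \<Rightarrow> nat \<Rightarrow> real" where
  "m_coeff A j i = (\<bar>A $$ (j,i)\<bar> + off_sum A j i (\<lambda>k. r_max A i)) / \<bar>A $$ (j,j)\<bar>"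

definition h_of :: "real mat \<Rightarrow> (nat \<Rightarrow> nat \<Rightarrow> real) \<Rightarrow> nat \<Rightarrow> real" where
  "h_of A q i = max_off A i
     (\<lambda>j. \<bar>A $$ (j,i)\<bar> / (\<bar>A $$ (j,j)\<bar> * q j i - off_sum A j i (\<lambda>k. q k i)))"

definition u_of :: "real mat \<Rightarrow> (nat \<Rightarrow> nat \<Rightarrow> real) \<Rightarrow> nat \<Rightarrow> nat \<Rightarrow> real" where
  "u_of A q j i =
     (\<bar>A $$ (j,i)\<bar> + off_sum A j i (\<lambda>k. q k i * h_of A q i)) / \<bar>A $$ (j,j)\<bar>"

definition p_of :: "real mat \<Rightarrow> (nat \<Rightarrow> nat \<Rightarrow> real) \<Rightarrow> nat \<Rightarrow> nat \<Rightarrow> real" where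
  "p_of A v j i = (\<bar>A $$ (j,i)\<bar> + off_sum A j i (\<lambda>k. v k i)) / \<bar>A $$ (j,j)\<bar>"

primrec u_iter :: "real mat \<Rightarrow> nat \<Rightarrow> nat \<Rightarrow> nat \<Rightarrow> real" where
  "u_iter A 0 = u_of A (m_coeff A)"
| "u_iter A (Suc t) = u_of A (p_of A (u_iter A t))"

text \<open>Only used for \<open>t \<ge> 1\<close>.\<close>

definition p_iter :: "real mat \<Rightarrow> nat \<Rightarrow> nat \<Rightarrow> nat \<Rightarrow> real" where
  "p_iter A t = p_of A (u_iter A (t - 1))"

lemma u_iter_eq: "t \<ge> 1 \<Longrightarrow> u_iter A t = u_of A (p_iter A t)"
  by (cases t) (simp_all add: p_iter_def)

end

theory Submission
  imports Defs
begin

text \<open>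
  Since \<open>1 / tau A\<close> is the spectral radius of the inverse, which is nonnegative, and a spectral
  radius is at most the largest absolute column sum (\<open>spectral_radius_le_column_sum\<close>), it is enough
  to bound each off-diagonal entry of the inverse by a multiple of the diagonal entry in its
  column, with $p^{(t)}_{ji}$ as the factor.

  Fix a column \<open>i\<close>. The relation \<open>A * inv_mat A = 1\<close> says that the ratios
  $\beta_j = \alpha_{ji} / \alpha_{ii}$ solve, for $j \neq i$, the linear system
  \[ |a_{jj}| \beta_j = |a_{ji}| + \sum_{k \neq j,i} |a_{jk}| \beta_k . \]
  By hypothesis its matrix is strictly diagonally dominant, so a minimum principle holds: every supersolution, a
  family satisfying the system with \<open>\<ge>\<close>, dominates the solution
  (\<open>supersolution_ge_solution\<close>).

  All quantities of the recursion are supersolutions. The constant family $r_i$ is one because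
  $r_i$ is a maximum of the quotients that a constant supersolution must dominate. The
  operator \<open>p_of\<close> is a Jacobi sweep of the system; it is monotone and lowers a supersolution
  pointwise, hence maps supersolutions to supersolutions. Finally, multiplying a
  supersolution \<open>q\<close> by the number \<open>h_of A q i\<close> gives a supersolution, as this number is
  the least nonnegative factor with that property. Since \<open>m_coeff\<close> is a sweep of $r_i$ and \<open>u_of A q\<close> is
  a sweep of the rescaled \<open>q\<close>, induction on \<open>t\<close> covers every $p^{(t)}$.
\<close>

section \<open>Supersolutions of the column systems\<close>

text \<open>
  The inequality \<open>w \<ge> p_of A w\<close>, restricted to column \<open>i\<close> and multiplied by the diagonal entry so
  that it contains no division.
\<close>

definition supersolution :: "real mat \<Rightarrow> nat \<Rightarrow> (nat \<Rightarrow> real) \<Rightarrow> bool" where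
  "supersolution A i w \<longleftrightarrow>
     (\<forall>j<dim_row A. j \<noteq> i \<longrightarrow> \<bar>A $$ (j,i)\<bar> + off_sum A j i w \<le> \<bar>A $$ (j,j)\<bar> * w j)"

definition dominant_off :: "real mat \<Rightarrow> nat \<Rightarrow> bool" where
  "dominant_off A i \<longleftrightarrow> (\<forall>j<dim_row A. j \<noteq> i \<longrightarrow> off_sum A j i (\<lambda>k. 1) < \<bar>A $$ (j,j)\<bar>)"

lemma off_sum_mono:
  assumes "\<And>k. k < dim_row A \<Longrightarrow> k \<noteq> i \<Longrightarrow> v k \<le> w k"
  shows "off_sum A j i v \<le> off_sum A j i w"
  unfolding off_sum_def by (rule sum_mono) (use assms in \<open>auto intro: mult_left_mono\<close>)

lemma off_sum_mult_right: "off_sum A j i (\<lambda>k. w k * c) = off_sum A j i w * c"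
  unfolding off_sum_def by (simp add: sum_distrib_right mult.assoc)

lemma off_sum_const: "off_sum A j i (\<lambda>k. c) = off_sum A j i (\<lambda>k. 1) * c"
  using off_sum_mult_right[of A j i "\<lambda>k. 1" c] by simp

lemma off_sum_diff: "off_sum A j i (\<lambda>k. v k - w k) = off_sum A j i v - off_sum A j i w"
  unfolding off_sum_def by (simp add: right_diff_distrib sum_subtractf)

lemma dominant_off_diag_pos:
  assumes "dominant_off A i" "j < dim_row A" "j \<noteq> i"
  shows "0 < \<bar>A $$ (j,j)\<bar>"
proof -
  have "0 \<le> off_sum A j i (\<lambda>k. 1)" unfolding off_sum_def by (simp add: sum_nonneg)
  then show ?thesis using assms unfolding dominant_off_def by (meson order_le_less_trans)
qed

text \<open>
  The minimum principle: at an index where \<open>w - b\<close> is smallest, the inequality of that row bounds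
  this smallest value below by a multiple of itself with factor less than one.
\<close>

lemma supersolution_ge_solution:
  assumes dom: "dominant_off A i" and w: "supersolution A i w"
    and b: "\<And>j. j < dim_row A \<Longrightarrow> j \<noteq> i \<Longrightarrow>
              \<bar>A $$ (j,j)\<bar> * b j = \<bar>A $$ (j,i)\<bar> + off_sum A j i b"
    and j: "j < dim_row A" "j \<noteq> i"
  shows "b j \<le> w j"
proof -
  let ?S = "{..<dim_row A} - {i}" and ?c = "\<lambda>k. w k - b k"
  have "finite ?S" "?S \<noteq> {}" using j by auto
  then obtain l where l: "l \<in> ?S" and min: "\<And>k. k \<in> ?S \<Longrightarrow> ?c l \<le> ?c k"
    using ex_min_if_finite[of "?c ` ?S"] by (force simp: not_less)
  have "off_sum A l i (\<lambda>k. 1) * ?c l = off_sum A l i (\<lambda>k. ?c l)"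
    by (rule off_sum_const[symmetric])
  also have "\<dots> \<le> off_sum A l i ?c" by (rule off_sum_mono) (use min in auto)
  also have "\<dots> = off_sum A l i w - off_sum A l i b" by (rule off_sum_diff)
  also have "\<dots> \<le> \<bar>A $$ (l,l)\<bar> * ?c l"
  proof -
    have "\<bar>A $$ (l,i)\<bar> + off_sum A l i w \<le> \<bar>A $$ (l,l)\<bar> * w l"
      using w l unfolding supersolution_def by auto
    moreover have "\<bar>A $$ (l,l)\<bar> * b l = \<bar>A $$ (l,i)\<bar> + off_sum A l i b"
      using b l by auto
    ultimately show ?thesis by (simp add: right_diff_distrib)
  qed
  finally have "0 \<le> (\<bar>A $$ (l,l)\<bar> - off_sum A l i (\<lambda>k. 1)) * ?c l"
    by (simp add: left_diff_distrib)
  moreover have "0 < \<bar>A $$ (l,l)\<bar> - off_sum A l i (\<lambda>k. 1)"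
    using dom l unfolding dominant_off_def by auto
  ultimately have "0 \<le> ?c l" by (simp add: zero_le_mult_iff)
  with min[of j] j show ?thesis by auto
qed

section \<open>The iterates are supersolutions\<close>

lemma max_off_ge:
  assumes "j < dim_row A" "j \<noteq> i"
  shows "f j \<le> max_off A i f"
  unfolding max_off_def by (rule Max_ge) (use assms in auto)

lemma supersolution_r_max:
  assumes "dominant_off A i"
  shows "supersolution A i (\<lambda>k. r_max A i)"
  unfolding supersolution_def
proof (intro allI impI)
  fix j assume j: "j < dim_row A" "j \<noteq> i"
  let ?d = "\<bar>A $$ (j,j)\<bar> - off_sum A j i (\<lambda>k. 1)"
  have "\<bar>A $$ (j,i)\<bar> / ?d \<le> r_max A i"
    unfolding r_max_def using max_off_ge[OF j] .
  moreover have "0 < ?d" using assms j unfolding dominant_off_def by auto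
  ultimately have "\<bar>A $$ (j,i)\<bar> \<le> r_max A i * ?d" by (simp add: pos_divide_le_eq)
  then show "\<bar>A $$ (j,i)\<bar> + off_sum A j i (\<lambda>k. r_max A i) \<le> \<bar>A $$ (j,j)\<bar> * r_max A i"
    unfolding off_sum_const[of A j i "r_max A i"] by (simp add: algebra_simps)
qed

text \<open>
  The sweep lowers \<open>v\<close>, and so it also lowers the right-hand sides that its own values have to
  dominate.
\<close>

lemma supersolution_p_of:
  assumes dom: "dominant_off A i" and v: "supersolution A i (\<lambda>k. v k i)"
  shows "supersolution A i (\<lambda>k. p_of A v k i)"
  unfolding supersolution_def
proof (intro allI impI)
  have le: "p_of A v k i \<le> v k i" if k: "k < dim_row A" "k \<noteq> i" for k
    using v k dominant_off_diag_pos[OF dom k] unfolding supersolution_def p_of_def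
    by (simp add: pos_divide_le_eq mult.commute)
  fix j assume j: "j < dim_row A" "j \<noteq> i"
  have "off_sum A j i (\<lambda>k. p_of A v k i) \<le> off_sum A j i (\<lambda>k. v k i)"
    by (rule off_sum_mono) (rule le)
  moreover have "\<bar>A $$ (j,j)\<bar> * p_of A v j i = \<bar>A $$ (j,i)\<bar> + off_sum A j i (\<lambda>k. v k i)"
    using dominant_off_diag_pos[OF dom j] unfolding p_of_def by simp
  ultimately show
    "\<bar>A $$ (j,i)\<bar> + off_sum A j i (\<lambda>k. p_of A v k i) \<le> \<bar>A $$ (j,j)\<bar> * p_of A v j i"
    by simp
qed

text \<open>
  Scaling \<open>q\<close> by \<open>c \<ge> 0\<close> gives a supersolution exactly if \<open>c\<close> times each denominator in
  \<open>h_of\<close> is at least the numerator. As \<open>q\<close> is a supersolution, the denominator is at least the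
  numerator, hence nonnegative, and a vanishing denominator forces the harmless quotient 0/0.
\<close>

lemma supersolution_mult_h_of:
  assumes q: "supersolution A i (\<lambda>k. q k i)"
  shows "supersolution A i (\<lambda>k. q k i * h_of A q i)"
  unfolding supersolution_def
proof (intro allI impI)
  fix j assume j: "j < dim_row A" "j \<noteq> i"
  let ?d = "\<bar>A $$ (j,j)\<bar> * q j i - off_sum A j i (\<lambda>k. q k i)"
  have d: "\<bar>A $$ (j,i)\<bar> \<le> ?d" using q j unfolding supersolution_def by (simp add: algebra_simps)
  have h: "\<bar>A $$ (j,i)\<bar> / ?d \<le> h_of A q i"
    unfolding h_of_def using max_off_ge[OF j] .
  have "\<bar>A $$ (j,i)\<bar> \<le> h_of A q i * ?d"
  proof (cases "?d = 0")
    case True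
    then show ?thesis using d by simp
  next
    case False
    then have "0 < ?d" using d by linarith
    then show ?thesis using h by (simp only: pos_divide_le_eq)
  qed
  then show "\<bar>A $$ (j,i)\<bar> + off_sum A j i (\<lambda>k. q k i * h_of A q i)
      \<le> \<bar>A $$ (j,j)\<bar> * (q j i * h_of A q i)"
    unfolding off_sum_mult_right by (simp add: algebra_simps)
qed

lemma m_coeff_eq_p_of: "m_coeff A = p_of A (\<lambda>k i. r_max A i)"
  by (intro ext) (simp add: m_coeff_def p_of_def)

lemma u_of_eq_p_of: "u_of A q = p_of A (\<lambda>k i. q k i * h_of A q i)"
  by (intro ext) (simp add: u_of_def p_of_def)

lemma supersolution_u_of:
  assumes "dominant_off A i" "supersolution A i (\<lambda>k. q k i)"
  shows "supersolution A i (\<lambda>k. u_of A q k i)"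
  unfolding u_of_eq_p_of
  by (rule supersolution_p_of[where v = "\<lambda>k i. q k i * h_of A q i"])
    (use assms supersolution_mult_h_of[of A i q] in auto)

lemma supersolution_u_iter:
  assumes "dominant_off A i"
  shows "supersolution A i (\<lambda>k. u_iter A t k i)"
proof (induction t)
  case 0
  have "supersolution A i (\<lambda>k. m_coeff A k i)"
    unfolding m_coeff_eq_p_of by (rule supersolution_p_of[where v = "\<lambda>k i. r_max A i"])
      (use assms supersolution_r_max in auto)
  then show ?case using supersolution_u_of[of A i "m_coeff A"] assms by simp
next
  case (Suc t)
  then have "supersolution A i (\<lambda>k. p_of A (u_iter A t) k i)"
    using supersolution_p_of[of A i "u_iter A t"] assms by simp
  then show ?case using supersolution_u_of[of A i "p_of A (u_iter A t)"] assms by simp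
qed

lemma supersolution_p_iter:
  assumes "dominant_off A i"
  shows "supersolution A i (\<lambda>k. p_iter A t k i)"
  unfolding p_iter_def
  by (rule supersolution_p_of[where v = "u_iter A (t - 1)"])
    (use assms supersolution_u_iter in auto)

section \<open>Entries of the inverse of an M-matrix\<close>

lemma M_matrix_inverse_entry:
  assumes A: "A \<in> M_matrices n" and ij: "i < n" "j < n"
  shows "A $$ (j,j) * inv_mat A $$ (j,i)
    = (if j = i then 1 else 0) + (\<Sum>k\<in>{..<n} - {j}. \<bar>A $$ (j,k)\<bar> * inv_mat A $$ (k,i))"
proof -
  have Ac: "A \<in> carrier_mat n n" and inv: "invertible_mat A"
    and sgn: "\<And>k. k < n \<Longrightarrow> k \<noteq> j \<Longrightarrow> A $$ (j,k) \<le> 0"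
    using A ij unfolding M_matrices_def by auto
  note B = inv_mat[OF Ac inv]
  have "(if j = i then 1 else 0) = (A * inv_mat A) $$ (j,i)" using ij B(2) by simp
  also have "\<dots> = (\<Sum>k<n. A $$ (j,k) * inv_mat A $$ (k,i))"
    using Ac B(1) ij by (auto simp: scalar_prod_def atLeast0LessThan)
  also have "\<dots> = A $$ (j,j) * inv_mat A $$ (j,i)
      + (\<Sum>k\<in>{..<n} - {j}. A $$ (j,k) * inv_mat A $$ (k,i))"
    using ij by (subst sum.remove[of _ j]) auto
  also have "(\<Sum>k\<in>{..<n} - {j}. A $$ (j,k) * inv_mat A $$ (k,i))
      = - (\<Sum>k\<in>{..<n} - {j}. \<bar>A $$ (j,k)\<bar> * inv_mat A $$ (k,i))"
    unfolding sum_negf[symmetric] by (rule sum.cong) (use sgn in auto)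
  finally show ?thesis by simp
qed

lemma M_matrix_diag_pos:
  assumes A: "A \<in> M_matrices n" and i: "i < n"
  shows "0 < A $$ (i,i)" "0 < inv_mat A $$ (i,i)"
proof -
  have nn: "\<And>k. k < n \<Longrightarrow> 0 \<le> inv_mat A $$ (k,i)"
    using A i unfolding M_matrices_def by auto
  then have "0 \<le> (\<Sum>k\<in>{..<n} - {i}. \<bar>A $$ (i,k)\<bar> * inv_mat A $$ (k,i))"
    by (intro sum_nonneg) auto
  then have "0 < A $$ (i,i) * inv_mat A $$ (i,i)"
    using M_matrix_inverse_entry[OF A i i] by simp
  then show "0 < A $$ (i,i)" "0 < inv_mat A $$ (i,i)"
    using nn[OF i] by (auto simp: zero_less_mult_iff)
qed

lemma M_matrix_inverse_entry_le:
  assumes A: "A \<in> M_matrices n" and dom: "dominant_off A i" and w: "supersolution A i w"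
    and ij: "i < n" "j < n" "j \<noteq> i"
  shows "inv_mat A $$ (j,i) \<le> w j * inv_mat A $$ (i,i)"
proof -
  let ?B = "inv_mat A"
  have n: "dim_row A = n" using A unfolding M_matrices_def by auto
  have pos: "0 < ?B $$ (i,i)" using M_matrix_diag_pos[OF A ij(1)] by simp
  have "?B $$ (j,i) / ?B $$ (i,i) \<le> w j"
  proof (rule supersolution_ge_solution[OF dom w, where b = "\<lambda>k. ?B $$ (k,i) / ?B $$ (i,i)"])
    fix l assume l: "l < dim_row A" "l \<noteq> i"
    have "\<bar>A $$ (l,l)\<bar> * ?B $$ (l,i) = (\<Sum>k\<in>{..<n} - {l}. \<bar>A $$ (l,k)\<bar> * ?B $$ (k,i))"
      using M_matrix_inverse_entry[OF A, of i l] M_matrix_diag_pos(1)[OF A, of l] ij l n by simp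
    also have "\<dots> = \<bar>A $$ (l,i)\<bar> * ?B $$ (i,i)
        + (\<Sum>k\<in>{..<n} - {l} - {i}. \<bar>A $$ (l,k)\<bar> * ?B $$ (k,i))"
      using l ij by (subst sum.remove[of _ i]) auto
    also have "{..<n} - {l} - {i} = {..<n} - {l,i}" by auto
    finally have "\<bar>A $$ (l,l)\<bar> * ?B $$ (l,i)
        = \<bar>A $$ (l,i)\<bar> * ?B $$ (i,i) + off_sum A l i (\<lambda>k. ?B $$ (k,i))"
      unfolding off_sum_def n .
    then show "\<bar>A $$ (l,l)\<bar> * (?B $$ (l,i) / ?B $$ (i,i))
        = \<bar>A $$ (l,i)\<bar> + off_sum A l i (\<lambda>k. ?B $$ (k,i) / ?B $$ (i,i))"
      using pos off_sum_mult_right[of A l i "\<lambda>k. ?B $$ (k,i)" "inverse (?B $$ (i,i))"]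
      by (simp add: field_simps)
  qed (use ij n in auto)
  then show ?thesis using pos by (simp add: pos_divide_le_eq)
qed

section \<open>Spectral radius and column sums\<close>

lemma spectral_radius_attained:
  assumes B: "B \<in> carrier_mat n n" and n: "n > 0"
  obtains l v where "cmod l = spectral_radius B" "B *\<^sub>v v = l \<cdot>\<^sub>v v"
    "v \<in> carrier_vec n" "v \<noteq> 0\<^sub>v n"
proof -
  obtain l where l: "cmod l = spectral_radius B" "eigenvalue B l"
    using spectral_radius_mem_max(1)[OF B n] unfolding spectrum_def by auto
  from l(2) B obtain v where "B *\<^sub>v v = l \<cdot>\<^sub>v v" "v \<in> carrier_vec n" "v \<noteq> 0\<^sub>v n"
    unfolding eigenvalue_def eigenvector_def by auto
  with l(1) show thesis by (rule that)
qed

text \<open>Taking the sum norm of both sides of \<open>B x = \<lambda> x\<close> gives the bound on every eigenvalue.\<close>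

lemma spectral_radius_le_column_sum:
  assumes B: "B \<in> carrier_mat n n" and n: "n > 0"
    and col: "\<And>j. j < n \<Longrightarrow> (\<Sum>i<n. cmod (B $$ (i,j))) \<le> M"
  shows "spectral_radius B \<le> M"
proof -
  obtain l v where l: "cmod l = spectral_radius B" "B *\<^sub>v v = l \<cdot>\<^sub>v v"
    and v: "v \<in> carrier_vec n" "v \<noteq> 0\<^sub>v n"
    using spectral_radius_attained[OF B n] .
  let ?s = "\<Sum>j<n. cmod (v $ j)"
  have "cmod l * ?s = (\<Sum>i<n. cmod ((B *\<^sub>v v) $ i))"
    using v(1) by (simp add: l(2) sum_distrib_left norm_mult)
  also have "\<dots> = (\<Sum>i<n. cmod (\<Sum>j<n. B $$ (i,j) * v $ j))"
    using B v(1) by (intro sum.cong) (auto simp: scalar_prod_def atLeast0LessThan)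
  also have "\<dots> \<le> (\<Sum>i<n. \<Sum>j<n. cmod (B $$ (i,j)) * cmod (v $ j))"
    by (intro sum_mono order_trans[OF norm_sum]) (simp add: norm_mult)
  also have "\<dots> = (\<Sum>j<n. (\<Sum>i<n. cmod (B $$ (i,j))) * cmod (v $ j))"
    by (subst sum.swap) (simp add: sum_distrib_right)
  also have "\<dots> \<le> (\<Sum>j<n. M * cmod (v $ j))"
    by (intro sum_mono mult_right_mono) (use col in auto)
  also have "\<dots> = M * ?s" by (simp add: sum_distrib_left)
  finally have le: "cmod l * ?s \<le> M * ?s" .
  obtain j where "j < n" "v $ j \<noteq> 0" using v by (metis carrier_vecD eq_vecI index_zero_vec)
  then have "0 < ?s" by (intro sum_pos2[of _ j]) auto
  with le l(1) show ?thesis by simp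
qed

text \<open>Zero is not an eigenvalue, as a left inverse exists.\<close>

lemma spectral_radius_pos:
  assumes B: "B \<in> carrier_mat n n" and A: "A \<in> carrier_mat n n" and n: "n > 0"
    and AB: "A * B = 1\<^sub>m n"
  shows "0 < spectral_radius B"
proof -
  obtain l v where l: "cmod l = spectral_radius B" and v: "v \<in> carrier_vec n" "v \<noteq> 0\<^sub>v n"
    and ev: "B *\<^sub>v v = l \<cdot>\<^sub>v v"
    using spectral_radius_attained[OF B n] by metis
  have "v = A *\<^sub>v (B *\<^sub>v v)"
    using AB v by (simp flip: assoc_mult_mat_vec[OF A B v(1)])
  then have v_eq: "v = l \<cdot>\<^sub>v (A *\<^sub>v v)" using ev mult_mat_vec[OF A v(1)] by simp
  have "0 \<cdot>\<^sub>v (A *\<^sub>v v) = 0\<^sub>v n" by (rule eq_vecI) (use A in auto)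
  then have "l \<noteq> 0" using v_eq v(2) by metis
  then show ?thesis using l by (metis zero_less_norm_iff)
qed

theorem theorem3:
  fixes A :: "real mat" and n t :: nat
  assumes "n \<ge> 2"
    and "A \<in> M_matrices n"
    and "\<And>i j. i < n \<Longrightarrow> j < n \<Longrightarrow> j \<noteq> i \<Longrightarrow>
           \<bar>A $$ (j,j)\<bar> - (\<Sum>k\<in>{..<n} - {j, i}. \<bar>A $$ (j,k)\<bar>) > 0"
    and "t \<ge> 1"
  shows "tau A \<ge> 1 / Max ((\<lambda>i. (1 + (\<Sum>k\<in>{..<n} - {i}. p_iter A t k i)) * inv_mat A $$ (i,i)) ` {..<n})"
proof -
  let ?c = "\<lambda>i. (1 + (\<Sum>k\<in>{..<n} - {i}. p_iter A t k i)) * inv_mat A $$ (i,i)"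
  let ?B = "map_mat complex_of_real (inv_mat A)"
  have Ac: "A \<in> carrier_mat n n" and inv: "invertible_mat A"
    and nonneg: "\<And>i j. i < n \<Longrightarrow> j < n \<Longrightarrow> 0 \<le> inv_mat A $$ (i,j)"
    using assms(2) unfolding M_matrices_def by auto
  note I = inv_mat[OF Ac inv]
  have n: "n > 0" using assms(1) by simp
  have Bc: "?B \<in> carrier_mat n n" using I(1) by simp
  have "map_mat complex_of_real A * ?B = map_mat complex_of_real (A * inv_mat A)"
    by (rule of_real_hom.mat_hom_mult[OF Ac I(1), symmetric])
  then have "map_mat complex_of_real A * ?B = 1\<^sub>m n"
    using I(2) by (simp add: of_real_hom.mat_hom_one)
  then have pos: "0 < spectral_radius ?B"
    using spectral_radius_pos[OF Bc map_carrier_mat[THEN iffD2, OF Ac] n] by simp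
  have "spectral_radius ?B \<le> Max (?c ` {..<n})"
  proof (rule spectral_radius_le_column_sum[OF Bc n])
    fix i assume i: "i < n"
    have dom: "dominant_off A i"
      using assms(3)[OF i] Ac unfolding dominant_off_def off_sum_def by auto
    have "(\<Sum>k<n. cmod (?B $$ (k,i))) = (\<Sum>k<n. inv_mat A $$ (k,i))"
      using I(1) i nonneg by (intro sum.cong) auto
    also have "\<dots> = inv_mat A $$ (i,i) + (\<Sum>k\<in>{..<n} - {i}. inv_mat A $$ (k,i))"
      using i by (subst sum.remove[of _ i]) auto
    also have "\<dots> \<le> inv_mat A $$ (i,i)
        + (\<Sum>k\<in>{..<n} - {i}. p_iter A t k i * inv_mat A $$ (i,i))"
      by (intro add_left_mono sum_mono
          M_matrix_inverse_entry_le[OF assms(2) dom supersolution_p_iter[OF dom] i]) auto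
    also have "\<dots> = ?c i" by (simp add: distrib_right sum_distrib_right)
    also have "\<dots> \<le> Max (?c ` {..<n})" using i by (intro Max_ge) auto
    finally show "(\<Sum>k<n. cmod (?B $$ (k,i))) \<le> Max (?c ` {..<n})" .
  qed
  then show ?thesis
    using le_imp_inverse_le[OF _ pos] unfolding tau_def by (simp add: inverse_eq_divide)
qed

end
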